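(* Let $n,t$ be positive integers. For a generic group $G\in\mathcal N_2(n,t)$ the following holds: $\operatorname{rk} Z(G)=2$ if $t=1$ and $n$ is odd, and $Z(G)=I(G')$ otherwise.
   Context: For a group $G$, $Z(G)$ is the center, $G'$ the commutator subgroup, and $I(G')=\{x\in G\mid x^k\in G'\text{ for some }k\ge 1\}$ the isolator of $G'$. $\operatorname{rk}$ is the (torsion-free) rank of an abelian group. $\mathcal N_2(n,t)$ is the set of all finitely generated torsion-free 2-step nilpotent groups $G$ with $\operatorname{rk}G'=t$ and $\operatorname{rk}G/I(G')=n$. Let $B_n(\mathbb Z)$ be the set of integer skew-symmetric (alternating) bilinear forms on $\mathbb Z^n$ with basis $a_1,\dots,a_n$, viewed as the subset of integer matrices in the space $B_n(\mathbb Q)$ of alternating bilinear forms on $\mathbb Q^n$. For a $t$-tuple $\Phi=(\varphi_1,\dots,\varphi_t)\in B_n(\mathbb Z)^t$, $G(\Phi)$ is the group of formal products $a_1^{k_1}\cdots a_n^{k_n}b_1^{l_1}\cdots b_t^{l_t}$ ($k_i,l_j\in\mathbb Z$) with multiplication $$a_1^{k_1}\cdots a_n^{k_n}b_1^{l_1}\cdots b_t^{l_t}\cdot a_1^{p_1}\cdots a_n^{p_n}b_1^{q_1}\cdots b_t^{q_t}=a_1^{k_1+p_1}\cdots a_n^{k_n+p_n}\prod_{m=1}^t b_m^{\,l_m+q_m+\sum_{i>j}k_ip_j\varphi_m(a_i,a_j)}.$$ Let $P_{n,t}\subset B_n(\mathbb Z)^t$ be the set of $t$-tuples of linearly independent forms.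 For $\Phi\in P_{n,t}$ the group $G(\Phi)$ lies in $\mathcal N_2(n,t)$, and every group in $\mathcal N_2(n,t)$ is isomorphic to some such $G(\Phi)$. Generic: a generic group of $\mathcal N_2(n,t)$ has an (isomorphism-invariant) property $\mathcal A$ if the set of $\Phi\in P_{n,t}$ such that $G(\Phi)$ does not have $\mathcal A$ is contained in some proper Zariski-closed subset of the affine space $B_n(\mathbb Q)^t$. *)

theory Defs
  imports
    "HOL-Algebra.Algebra"
    "HOL-Library.Extended_Nat"
    "Jordan_Normal_Form.Determinant"
begin

section \<open>Groups\<close>

definition center :: "('a, 'b) monoid_scheme \<Rightarrow> 'a set" where
  "center G = {z \<in> carrier G. \<forall>x \<in> carrier G. z \<otimes>\<^bsub>G\<^esub> x = x \<otimes>\<^bsub>G\<^esub> z}"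

abbreviation commutator_subgroup :: "('a, 'b) monoid_scheme \<Rightarrow> 'a set" where
  "commutator_subgroup G \<equiv> derived G (carrier G)"

definition isolator :: "('a, 'b) monoid_scheme \<Rightarrow> 'a set \<Rightarrow> 'a set" where
  "isolator G H = {x \<in> carrier G. \<exists>k::nat. k \<ge> 1 \<and> x [^]\<^bsub>G\<^esub> k \<in> H}"

definition int_independent :: "('a, 'b) monoid_scheme \<Rightarrow> 'a set \<Rightarrow> bool" where
  "int_independent G S \<longleftrightarrow> S \<subseteq> carrier G \<and> finite S \<and>
     (\<forall>c :: 'a \<Rightarrow> int. (\<Otimes>\<^bsub>G\<^esub>x\<in>S. x [^]\<^bsub>G\<^esub> c x) = \<one>\<^bsub>G\<^esub> \<longrightarrow> (\<forall>x\<in>S. c x = 0))"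

text \<open>Torsion-free rank; meaningful for abelian groups only. It is \<open>\<infinity>\<close> if there are
  arbitrarily large finite independent sets.\<close>

definition ab_rank :: "('a, 'b) monoid_scheme \<Rightarrow> enat" where
  "ab_rank G = (SUP S \<in> {S. int_independent G S}. enat (card S))"

definition finitely_generated_group :: "('a, 'b) monoid_scheme \<Rightarrow> bool" where
  "finitely_generated_group G \<longleftrightarrow>
     (\<exists>S. finite S \<and> S \<subseteq> carrier G \<and> generate G S = carrier G)"

definition torsion_free_group :: "('a, 'b) monoid_scheme \<Rightarrow> bool" where
  "torsion_free_group G \<longleftrightarrow>
     (\<forall>x \<in> carrier G. \<forall>k::nat. k \<ge> 1 \<longrightarrow> x [^]\<^bsub>G\<^esub> k = \<one>\<^bsub>G\<^esub> \<longrightarrow> x = \<one>\<^bsub>G\<^esub>)"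

definition two_step_nilpotent :: "('a, 'b) monoid_scheme \<Rightarrow> bool" where
  "two_step_nilpotent G \<longleftrightarrow>
     commutator_subgroup G \<subseteq> center G \<and> commutator_subgroup G \<noteq> {\<one>\<^bsub>G\<^esub>}"

definition N2 :: "nat \<Rightarrow> nat \<Rightarrow> 'a monoid set" where
  "N2 n t = {G. group G \<and> finitely_generated_group G \<and> torsion_free_group G \<and>
     two_step_nilpotent G \<and>
     ab_rank (G\<lparr>carrier := commutator_subgroup G\<rparr>) = enat t \<and>
     ab_rank (G Mod isolator G (commutator_subgroup G)) = enat n}"

section \<open>Tuples of alternating forms\<close>

text \<open>A form is given by its Gram matrix in the standard basis; indices start at 0.\<close>

definition alt_forms :: "nat \<Rightarrow> 'a :: comm_ring_1 mat set" where
  "alt_forms n = {A \<in> carrier_mat n n.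
     (\<forall>i<n. A $$ (i, i) = 0) \<and> (\<forall>i<n. \<forall>j<n. A $$ (i, j) = - A $$ (j, i))}"

definition alt_tuples :: "nat \<Rightarrow> nat \<Rightarrow> 'a :: comm_ring_1 mat list set" where
  "alt_tuples n t = {\<Phi>. length \<Phi> = t \<and> set \<Phi> \<subseteq> alt_forms n}"

abbreviation rat_tuple :: "int mat list \<Rightarrow> rat mat list" where
  "rat_tuple \<equiv> map (map_mat rat_of_int)"

definition lin_indep_tuple :: "nat \<Rightarrow> nat \<Rightarrow> rat mat list \<Rightarrow> bool" where
  "lin_indep_tuple n t \<Phi> \<longleftrightarrow>
     (\<forall>c :: nat \<Rightarrow> rat. (\<forall>i<n. \<forall>j<n. (\<Sum>m<t. c m * (\<Phi> ! m) $$ (i, j)) = 0)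
        \<longrightarrow> (\<forall>m<t. c m = 0))"

definition P_tuples :: "nat \<Rightarrow> nat \<Rightarrow> int mat list set" where
  "P_tuples n t = {\<Phi> \<in> alt_tuples n t. lin_indep_tuple n t (rat_tuple \<Phi>)}"

text \<open>The pair \<open>(k, l)\<close> stands for the formal product
  \<open>a\<^sub>1\<^bsup>k\<^sub>1\<^esup> \<dots> a\<^sub>n\<^bsup>k\<^sub>n\<^esup> b\<^sub>1\<^bsup>l\<^sub>1\<^esup> \<dots> b\<^sub>t\<^bsup>l\<^sub>t\<^esup>\<close>.\<close>

definition form_group :: "nat \<Rightarrow> nat \<Rightarrow> int mat list \<Rightarrow> (int vec \<times> int vec) monoid" where
  "form_group n t \<Phi> =
    \<lparr>carrier = carrier_vec n \<times> carrier_vec t,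
     monoid.mult = (\<lambda>(k, l) (p, q).
       (k + p, l + q + vec t (\<lambda>m. \<Sum>i<n. \<Sum>j<i. k $ i * p $ j * (\<Phi> ! m) $$ (i, j)))),
     monoid.one = (0\<^sub>v n, 0\<^sub>v t)\<rparr>"

section \<open>Zariski-closed sets and generic properties\<close>

inductive_set polynomial_functions :: "nat \<Rightarrow> nat \<Rightarrow> (rat mat list \<Rightarrow> rat) set"
  for n t :: nat where
  const: "(\<lambda>_. c) \<in> polynomial_functions n t"
| coord: "m < t \<Longrightarrow> i < n \<Longrightarrow> j < n \<Longrightarrow> (\<lambda>\<Phi>. (\<Phi> ! m) $$ (i, j)) \<in> polynomial_functions n t"
| add: "f \<in> polynomial_functions n t \<Longrightarrow> g \<in> polynomial_functions n t \<Longrightarrow>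
    (\<lambda>\<Phi>. f \<Phi> + g \<Phi>) \<in> polynomial_functions n t"
| mult: "f \<in> polynomial_functions n t \<Longrightarrow> g \<in> polynomial_functions n t \<Longrightarrow>
    (\<lambda>\<Phi>. f \<Phi> * g \<Phi>) \<in> polynomial_functions n t"

definition zariski_closed :: "nat \<Rightarrow> nat \<Rightarrow> rat mat list set \<Rightarrow> bool" where
  "zariski_closed n t V \<longleftrightarrow>
     (\<exists>F \<subseteq> polynomial_functions n t. V = {\<Phi> \<in> alt_tuples n t. \<forall>f \<in> F. f \<Phi> = 0})"

definition iso_invariant_on :: "'a monoid set \<Rightarrow> ('a monoid \<Rightarrow> bool) \<Rightarrow> bool" where
  "iso_invariant_on \<C> \<A> \<longleftrightarrow> (\<forall>G\<in>\<C>. \<forall>H\<in>\<C>. G \<cong> H \<longrightarrow> \<A> G \<longrightarrow> \<A> H)"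

text \<open>Every group in \<open>N2 n t\<close> is isomorphic to some \<open>form_group n t \<Phi>\<close>, so nothing is lost by
  fixing the element type of the groups on which a property is evaluated.\<close>

definition generic_N2 :: "nat \<Rightarrow> nat \<Rightarrow> ((int vec \<times> int vec) monoid \<Rightarrow> bool) \<Rightarrow> bool" where
  "generic_N2 n t \<A> \<longleftrightarrow> iso_invariant_on (N2 n t) \<A> \<and>
     (\<exists>V. zariski_closed n t V \<and> V \<subset> alt_tuples n t \<and>
        rat_tuple ` {\<Phi> \<in> P_tuples n t. \<not> \<A> (form_group n t \<Phi>)} \<subseteq> V)"

end

theory Submission
  imports Defs
begin

text \<open>An element \<open>(k, l)\<close> of \<open>G(\<Phi>)\<close> is central iff \<open>k\<close> lies in the common kernel of the forms, and
  linear independence of \<open>\<Phi>\<close> gives \<open>I(G') = {(0, l)}\<close>. Over an ordered field, a family of linear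
  forms has trivial common kernel iff its Gram determinant is nonzero, because
  \<open>v\<^sup>T W\<^sup>T W v\<close> is a sum of squares. Applied to all rows of all forms this gives a polynomial whose
  nonvanishing makes the common kernel trivial. If \<open>t = 1\<close> and \<open>n\<close> is odd, the kernel is never
  trivial; adding the last coordinate to the family gives a polynomial whose nonvanishing
  makes the kernel a line, and the center is then an extension of one infinite cyclic group by
  another.\<close>

section \<open>Isomorphism invariance\<close>

lemma center_carrier: "z \<in> center G \<Longrightarrow> z \<in> carrier G"
  by (simp add: center_def)

lemma center_commute: "z \<in> center G \<Longrightarrow> x \<in> carrier G \<Longrightarrow> z \<otimes>\<^bsub>G\<^esub> x = x \<otimes>\<^bsub>G\<^esub> z"
  by (simp add: center_def)

lemma centerI:
  "z \<in> carrier G \<Longrightarrow> (\<And>x. x \<in> carrier G \<Longrightarrow> z \<otimes>\<^bsub>G\<^esub> x = x \<otimes>\<^bsub>G\<^esub> z) \<Longrightarrow> z \<in> center G"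
  by (simp add: center_def)

lemma (in group) center_subgroup: "subgroup (center G) G"
proof (rule subgroupI)
  show "center G \<subseteq> carrier G"
    by (auto simp: center_def)
  show "center G \<noteq> {}"
    by (auto simp: center_def intro!: exI[of _ \<one>])
next
  fix z assume z: "z \<in> center G"
  then have zc: "z \<in> carrier G" and comm: "\<And>x. x \<in> carrier G \<Longrightarrow> z \<otimes> x = x \<otimes> z"
    by (auto simp: center_def)
  \<comment> \<open>Commute \<open>z\<close> past the inverse of \<open>x\<close> and invert both
    sides.\<close>
  have "inv z \<otimes> x = x \<otimes> inv z" if x: "x \<in> carrier G" for x
    using arg_cong[OF comm[OF inv_closed[OF x]], of "m_inv G"] x zc by (simp add: inv_mult_group)
  then show "inv z \<in> center G"
    using zc by (auto simp: center_def)
next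
  fix y z assume "y \<in> center G" "z \<in> center G"
  then have yz: "y \<in> carrier G" "z \<in> carrier G"
    and comm: "\<And>x. x \<in> carrier G \<Longrightarrow> y \<otimes> x = x \<otimes> y" "\<And>x. x \<in> carrier G \<Longrightarrow> z \<otimes> x = x \<otimes> z"
    by (auto simp: center_def)
  have "(y \<otimes> z) \<otimes> x = x \<otimes> (y \<otimes> z)" if x: "x \<in> carrier G" for x
  proof -
    have "(y \<otimes> z) \<otimes> x = (y \<otimes> x) \<otimes> z"
      using x yz by (simp add: m_assoc comm(2)[OF x])
    also have "\<dots> = x \<otimes> (y \<otimes> z)"
      using x yz by (simp add: m_assoc comm(1)[OF x])
    finally show ?thesis .
  qed
  then show "y \<otimes> z \<in> center G"
    using yz by (auto simp: center_def)
qed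

lemma (in group) comm_group_center: "comm_group (G\<lparr>carrier := center G\<rparr>)"
proof -
  interpret Z: group "G\<lparr>carrier := center G\<rparr>"
    by (rule subgroup_imp_group[OF center_subgroup])
  show ?thesis
    by (rule Z.group_comm_groupI) (simp add: center_commute center_carrier)
qed

lemma center_iso_image:
  assumes "group G" "group H" and h: "h \<in> iso G H"
  shows "h ` center G = center H"
proof -
  interpret group_hom G H h
    using assms by (auto simp: group_hom_def group_hom_axioms_def iso_def)
  have inj: "inj_on h (carrier G)" and surj: "h ` carrier G = carrier H"
    using h by (auto simp: iso_def bij_betw_def)
  show ?thesis
  proof (intro equalityI subsetI)
    fix y assume "y \<in> h ` center G"
    then obtain z where z: "z \<in> center G" "y = h z" by blast
    have "h z \<otimes>\<^bsub>H\<^esub> x = x \<otimes>\<^bsub>H\<^esub> h z" if x: "x \<in> carrier H" for x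
    proof -
      obtain u where u: "u \<in> carrier G" "x = h u"
        using x unfolding surj[symmetric] by blast
      have "h (z \<otimes>\<^bsub>G\<^esub> u) = h (u \<otimes>\<^bsub>G\<^esub> z)"
        by (simp only: center_commute[OF z(1) u(1)])
      then show ?thesis
        using center_carrier[OF z(1)] u by simp
    qed
    then show "y \<in> center H"
      using center_carrier[OF z(1)] z(2) by (auto intro: centerI)
  next
    fix y assume y: "y \<in> center H"
    then obtain z where z: "z \<in> carrier G" "y = h z"
      using surj by (metis center_carrier imageE)
    have "z \<otimes>\<^bsub>G\<^esub> x = x \<otimes>\<^bsub>G\<^esub> z" if x: "x \<in> carrier G" for x
    proof (rule inj_onD[OF inj])
      show "h (z \<otimes>\<^bsub>G\<^esub> x) = h (x \<otimes>\<^bsub>G\<^esub> z)"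
        using center_commute[OF y, of "h x"] x z by simp
    qed (use x z in auto)
    then show "y \<in> h ` center G"
      using z by (auto intro: centerI)
  qed
qed

lemma isolator_iso_image:
  assumes "group G" "group H" and h: "h \<in> iso G H" and K: "K \<subseteq> carrier G"
  shows "h ` isolator G K = isolator H (h ` K)"
proof -
  interpret group_hom G H h
    using assms by (auto simp: group_hom_def group_hom_axioms_def iso_def)
  have inj: "inj_on h (carrier G)" and surj: "h ` carrier G = carrier H"
    using h by (auto simp: iso_def bij_betw_def)
  have mem: "h x [^]\<^bsub>H\<^esub> k \<in> h ` K \<longleftrightarrow> x [^]\<^bsub>G\<^esub> k \<in> K" if "x \<in> carrier G" for x and k :: nat
    using inj_on_image_mem_iff[OF inj _ K, of "x [^]\<^bsub>G\<^esub> k"] that by (simp add: hom_nat_pow)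
  show ?thesis
    unfolding isolator_def surj[symmetric] using mem by fast
qed

section \<open>Products, independence and rank under homomorphisms of abelian groups\<close>

lemma (in comm_monoid) hom_finprod:
  assumes "comm_monoid H" and "h \<in> hom G H" and "h \<one> = \<one>\<^bsub>H\<^esub>" and "f \<in> A \<rightarrow> carrier G"
  shows "h (finprod G f A) = finprod H (\<lambda>x. h (f x)) A"
proof -
  interpret H: comm_monoid H by fact
  show ?thesis
    using assms(4)
  proof (induction A rule: infinite_finite_induct)
    case (insert a A)
    then show ?case
      using assms(2) by (simp add: hom_mult[OF assms(2)] Pi_iff hom_in_carrier)
  \<comment> \<open>A product over an infinite set is \<one> by convention, so the infinite case,
    like the empty one, rests on \<open>h\<close> preserving the unit.\<close>
  qed (use assms(3) in auto)
qed

lemma hom_finprod_int_pow: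
  assumes "comm_group G" "comm_group H" and h: "h \<in> hom G H" and S: "S \<subseteq> carrier G"
  shows "h (\<Otimes>\<^bsub>G\<^esub>x\<in>S. x [^]\<^bsub>G\<^esub> (c x :: int)) = (\<Otimes>\<^bsub>H\<^esub>x\<in>S. h x [^]\<^bsub>H\<^esub> c x)"
proof -
  interpret G: comm_group G by fact
  interpret H: comm_group H by fact
  interpret group_hom G H h
    by unfold_locales fact
  have "h (\<Otimes>\<^bsub>G\<^esub>x\<in>S. x [^]\<^bsub>G\<^esub> c x) = (\<Otimes>\<^bsub>H\<^esub>x\<in>S. h (x [^]\<^bsub>G\<^esub> c x))"
    using S by (intro G.hom_finprod) (auto intro: H.comm_monoid_axioms)
  also have "\<dots> = (\<Otimes>\<^bsub>H\<^esub>x\<in>S. h x [^]\<^bsub>H\<^esub> c x)"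
    using S by (intro H.finprod_cong') (auto simp: hom_int_pow)
  finally show ?thesis .
qed

text \<open>A relation among the images with exponents \<open>c\<close> is the image of the relation
  in \<open>S\<close> with exponents \<open>c (h x)\<close>, and injectivity carries it back to
  \<open>G\<close>.\<close>

lemma int_independent_mon_image:
  assumes "comm_group G" "comm_group H" and h: "h \<in> hom G H" and inj: "inj_on h (carrier G)"
    and S: "int_independent G S"
  shows "int_independent H (h ` S)"
proof -
  interpret G: comm_group G by fact
  interpret H: comm_group H by fact
  interpret group_hom G H h
    by unfold_locales fact
  have SG: "S \<subseteq> carrier G" and fin: "finite S"
    using S by (auto simp: int_independent_def)
  have injS: "inj_on h S"
    using inj SG by (rule inj_on_subset)
  have "\<forall>x\<in>h ` S. c x = 0" if c: "(\<Otimes>\<^bsub>H\<^esub>x\<in>h ` S. x [^]\<^bsub>H\<^esub> c x) = \<one>\<^bsub>H\<^esub>" for c :: "_ \<Rightarrow> int"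
  proof -
    have "h (\<Otimes>\<^bsub>G\<^esub>x\<in>S. x [^]\<^bsub>G\<^esub> c (h x)) = (\<Otimes>\<^bsub>H\<^esub>x\<in>S. h x [^]\<^bsub>H\<^esub> c (h x))"
      by (rule hom_finprod_int_pow) (use assms SG in auto)
    also have "\<dots> = h \<one>\<^bsub>G\<^esub>"
      using c injS SG by (subst (asm) H.finprod_reindex) auto
    finally have "(\<Otimes>\<^bsub>G\<^esub>x\<in>S. x [^]\<^bsub>G\<^esub> c (h x)) = \<one>\<^bsub>G\<^esub>"
      using SG by (intro inj_onD[OF inj]) (auto intro!: G.finprod_closed)
    then show ?thesis
      using S by (auto simp: int_independent_def)
  qed
  then show ?thesis
    using SG fin by (auto simp: int_independent_def)
qed

lemma ab_rank_iso_le: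
  assumes "comm_group G" "comm_group H" and h: "h \<in> iso G H"
  shows "ab_rank G \<le> ab_rank H"
  unfolding ab_rank_def
proof (rule SUP_mono, clarify)
  fix S assume S: "int_independent G S"
  have "inj_on h (carrier G)" "h \<in> hom G H"
    using h by (auto simp: iso_def bij_betw_def)
  moreover from this(1) have "inj_on h S"
    using S by (auto simp: int_independent_def intro: inj_on_subset)
  ultimately show "\<exists>T\<in>{S. int_independent H S}. enat (card S) \<le> enat (card T)"
    using int_independent_mon_image[OF assms(1,2) _ _ S] by (auto simp: card_image intro!: exI[of _ "h ` S"])
qed

lemma ab_rank_iso:
  assumes "comm_group G" "comm_group H" and h: "h \<in> iso G H"
  shows "ab_rank G = ab_rank H"
  using assms comm_group.axioms(2) group.iso_set_sym
  by (metis ab_rank_iso_le order_antisym)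

lemma ab_rank_center_iso:
  assumes "group G" "group H" and h: "h \<in> iso G H"
  shows "ab_rank (G\<lparr>carrier := center G\<rparr>) = ab_rank (H\<lparr>carrier := center H\<rparr>)"
  using ab_rank_iso[OF group.comm_group_center group.comm_group_center
      iso_restrict[OF h _ _ group.center_subgroup, unfolded center_iso_image[OF assms]]] assms
  by (simp add: center_iso_image)

lemma isolator_commutator_subgroup_iso_image:
  assumes "group G" "group H" and h: "h \<in> iso G H"
  shows "h ` isolator G (commutator_subgroup G) = isolator H (commutator_subgroup H)"
proof -
  interpret group_hom G H h
    using assms by (auto simp: group_hom_def group_hom_axioms_def iso_def)
  have "h ` commutator_subgroup G = commutator_subgroup H"
    using derived_img[of "carrier G"] h by (simp add: iso_def bij_betw_def)
  then show ?thesis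
    using isolator_iso_image[OF assms G.derived_in_carrier[OF order_refl]] by simp
qed

section \<open>Rank bounds\<close>

text \<open>Three vectors in Z^2 are dependent. If some 2x2 minor is nonzero, the cross product of
  \<open>f\<close> and \<open>g\<close> gives the coefficients. Otherwise either the vector with
  index 0 vanishes, or the vectors with indices 0 and 1 are proportional and a nonzero coordinate of
  the former gives a relation.\<close>

lemma int_dependent_three:
  fixes f g :: "nat \<Rightarrow> int"
  shows "\<exists>c :: nat \<Rightarrow> int. (\<exists>i<3. c i \<noteq> 0) \<and> (\<Sum>i<3. c i * f i) = 0 \<and> (\<Sum>i<3. c i * g i) = 0"
proof -
  define p where "p i j = f i * g j - f j * g i" for i j
  have *: ?thesis if "c 0 * f 0 + c 1 * f 1 + c 2 * f 2 = 0" "c 0 * g 0 + c 1 * g 1 + c 2 * g 2 = 0"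
    "c 0 \<noteq> 0 \<or> c 1 \<noteq> 0 \<or> c 2 \<noteq> 0" for c :: "nat \<Rightarrow> int"
    using that by (intro exI[of _ c]) (auto simp: numeral_eq_Suc)
  consider "p 0 1 \<noteq> 0 \<or> p 0 2 \<noteq> 0 \<or> p 1 2 \<noteq> 0" | "f 0 = 0" "g 0 = 0"
    | "p 0 1 = 0" "f 0 \<noteq> 0 \<or> g 0 \<noteq> 0"
    by blast
  then show ?thesis
  proof cases
    case 1
    then show ?thesis
      by (intro *[of "\<lambda>i. if i = 0 then p 1 2 else if i = 1 then - p 0 2 else p 0 1"])
        (auto simp: p_def algebra_simps)
  next
    case 2
    then show ?thesis
      by (intro *[of "\<lambda>i. if i = 0 then 1 else 0"]) auto
  next
    case 3
    show ?thesis
    proof (cases "f 0 = 0")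
      case True
      then show ?thesis
        using 3 by (intro *[of "\<lambda>i. if i = 0 then g 1 else if i = 1 then - g 0 else 0"])
          (auto simp: p_def algebra_simps)
    next
      case False
      then show ?thesis
        using 3 by (intro *[of "\<lambda>i. if i = 0 then f 1 else if i = 1 then - f 0 else 0"])
          (auto simp: p_def algebra_simps)
    qed
  qed
qed

lemma hom_integer_group_finprod_int_pow:
  assumes "comm_group G" and h: "h \<in> hom G integer_group" and S: "S \<subseteq> carrier G" "finite S"
  shows "h (\<Otimes>\<^bsub>G\<^esub>x\<in>S. x [^]\<^bsub>G\<^esub> (c x :: int)) = (\<Sum>x\<in>S. c x * h x)"
proof -
  interpret I: comm_group integer_group
    by (rule abelian_integer_group)
  have "finprod integer_group u S = sum u S" for u :: "_ \<Rightarrow> int"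
    using S(2) by (induction S) auto
  then show ?thesis
    using hom_finprod_int_pow[OF assms(1) abelian_integer_group h S(1)] by simp
qed

text \<open>Together \<open>f\<close> and \<open>g\<close> embed \<open>G\<close> into Z^2, where
  any three elements satisfy a nontrivial relation.\<close>

lemma ab_rank_le_2:
  assumes "comm_group G" and f: "f \<in> hom G integer_group" and g: "g \<in> hom G integer_group"
    and inj: "\<And>x. x \<in> carrier G \<Longrightarrow> f x = 0 \<Longrightarrow> g x = 0 \<Longrightarrow> x = \<one>\<^bsub>G\<^esub>"
  shows "ab_rank G \<le> 2"
  unfolding ab_rank_def
proof (rule SUP_least, clarify)
  interpret G: comm_group G by fact
  fix S assume S: "int_independent G S"
  have SG: "S \<subseteq> carrier G" and fin: "finite S"
    using S by (auto simp: int_independent_def)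
  note eval = hom_integer_group_finprod_int_pow[OF \<open>comm_group G\<close> _ SG fin]
  have "card S \<le> 2"
  proof (rule ccontr)
    assume "\<not> card S \<le> 2"
    then have "3 \<le> card S"
      by simp
    then obtain T where T: "T \<subseteq> S" "card T = 3"
      by (rule obtain_subset_with_card_n)
    then have finT: "finite T"
      using fin finite_subset by blast
    obtain e where e: "bij_betw e {..<3::nat} T"
      using ex_bij_betw_nat_finite[OF finT] T by (auto simp: atLeast0LessThan)
    obtain c :: "nat \<Rightarrow> int" where c: "\<exists>i<3. c i \<noteq> 0"
      "(\<Sum>i<3. c i * f (e i)) = 0" "(\<Sum>i<3. c i * g (e i)) = 0"
      using int_dependent_three[of "\<lambda>i. f (e i)" "\<lambda>i. g (e i)"] by blast
    \<comment> \<open>The relation found on the three elements of \<open>T\<close>, extended by zero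
      to a relation on all of \<open>S\<close>.\<close>
    define d where "d x = (if x \<in> T then c (the_inv_into {..<3} e x) else 0)" for x
    have de: "d (e i) = c i" if "i < 3" for i
      using e that by (auto simp: d_def bij_betw_def the_inv_into_f_f)
    have sum_d: "(\<Sum>x\<in>S. d x * u x) = (\<Sum>i<3. c i * u (e i))" for u
    proof -
      have "(\<Sum>x\<in>S. d x * u x) = (\<Sum>x\<in>T. d x * u x)"
        using T fin by (intro sum.mono_neutral_right) (auto simp: d_def)
      also have "\<dots> = (\<Sum>i<3. d (e i) * u (e i))"
        by (rule sum.reindex_bij_betw[OF e, symmetric])
      finally show ?thesis
        by (simp add: de)
    qed
    have "(\<Otimes>\<^bsub>G\<^esub>x\<in>S. x [^]\<^bsub>G\<^esub> d x) = \<one>\<^bsub>G\<^esub>"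
      using SG by (intro inj) (auto simp: eval[OF f] eval[OF g] sum_d c intro!: G.finprod_closed)
    then have "\<forall>x\<in>S. d x = 0"
      using S by (auto simp: int_independent_def)
    moreover obtain i where "i < 3" "c i \<noteq> 0"
      using c by blast
    moreover from this have "e i \<in> S"
      using e T by (auto simp: bij_betw_def)
    ultimately show False
      using de by auto
  qed
  then show "enat (card S) \<le> 2"
    by (simp add: numeral_eq_enat)
qed

text \<open>The values of \<open>(f, g)\<close> at \<open>x\<close> and \<open>y\<close> form a
  triangular matrix with nonzero diagonal: applying \<open>f\<close> to a relation kills the
  exponent of \<open>x\<close>, then \<open>g\<close> kills that of \<open>y\<close>.\<close>

lemma ab_rank_ge_2:
  assumes "comm_group G" and f: "f \<in> hom G integer_group" and g: "g \<in> hom G integer_group"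
    and xy: "x \<in> carrier G" "y \<in> carrier G" and "f x \<noteq> 0" "f y = 0" "g y \<noteq> 0"
  shows "2 \<le> ab_rank G"
proof -
  interpret G: comm_group G by fact
  have "x \<noteq> y"
    using assms by auto
  have "c x = 0 \<and> c y = 0" if c: "(\<Otimes>\<^bsub>G\<^esub>z\<in>{x, y}. z [^]\<^bsub>G\<^esub> c z) = \<one>\<^bsub>G\<^esub>" for c :: "_ \<Rightarrow> int"
  proof -
    have sum: "(\<Sum>z\<in>{x, y}. c z * h z) = 0" if "h \<in> hom G integer_group" for h
      using hom_integer_group_finprod_int_pow[OF \<open>comm_group G\<close> that, of "{x, y}" c] c xy
        hom_one[OF that G.is_group group_integer_group] by simp
    show ?thesis
      using sum[OF f] sum[OF g] \<open>x \<noteq> y\<close> assms by simp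
  qed
  then have "int_independent G {x, y}"
    using xy by (auto simp: int_independent_def)
  then have "enat (card {x, y}) \<le> ab_rank G"
    unfolding ab_rank_def by (intro SUP_upper) simp
  moreover have "card {x, y} = 2"
    using \<open>x \<noteq> y\<close> by simp
  ultimately show ?thesis
    by (simp only: numeral_eq_enat)
qed

section \<open>Gram determinants and polynomial functions\<close>

text \<open>This is W^T W for the matrix W whose rows are the \<open>w r\<close>. Indexing rows by a
  set avoids having to number them.\<close>

definition gram_mat :: "nat \<Rightarrow> 'b set \<Rightarrow> ('b \<Rightarrow> nat \<Rightarrow> 'a :: comm_ring_1) \<Rightarrow> 'a mat" where
  "gram_mat n I w = mat n n (\<lambda>(i, j). \<Sum>r\<in>I. w r i * w r j)"

lemma gram_mat_carrier [simp]: "gram_mat n I w \<in> carrier_mat n n"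
  by (simp add: gram_mat_def)

lemma gram_mat_mult_vec:
  assumes "v \<in> carrier_vec n" and "i < n"
  shows "(gram_mat n I w *\<^sub>v v) $ i = (\<Sum>r\<in>I. w r i * (\<Sum>j<n. w r j * v $ j))"
proof -
  have "(gram_mat n I w *\<^sub>v v) $ i = (\<Sum>j<n. (\<Sum>r\<in>I. w r i * w r j) * v $ j)"
    using assms by (simp add: gram_mat_def scalar_prod_def atLeast0LessThan)
  also have "\<dots> = (\<Sum>r\<in>I. \<Sum>j<n. w r i * w r j * v $ j)"
    by (subst sum.swap) (simp add: sum_distrib_right)
  finally show ?thesis
    by (simp add: sum_distrib_left mult.assoc)
qed

text \<open>One determinant thus replaces the condition that some maximal minor of W be nonzero. It
  is applied over the rationals to \<open>kernel_poly\<close> and over the integers to the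
  isolator.\<close>

lemma det_gram_mat_nonzero_iff:
  fixes w :: "'b \<Rightarrow> nat \<Rightarrow> 'a :: linordered_idom"
  assumes fin: "finite I"
  shows "det (gram_mat n I w) \<noteq> 0 \<longleftrightarrow>
    (\<forall>x. (\<forall>r\<in>I. (\<Sum>i<n. w r i * x i) = 0) \<longrightarrow> (\<forall>i<n. x i = 0))" (is "?L \<longleftrightarrow> ?R")
proof
  assume L: ?L
  show ?R
  proof (intro allI impI)
    fix x i assume x: "\<forall>r\<in>I. (\<Sum>i<n. w r i * x i) = 0" and i: "i < n"
    have "gram_mat n I w *\<^sub>v vec n x = 0\<^sub>v n"
    proof (rule eq_vecI)
      fix i assume "i < dim_vec (0\<^sub>v n :: 'a vec)"
      then show "(gram_mat n I w *\<^sub>v vec n x) $ i = 0\<^sub>v n $ i"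
        using x by (simp add: gram_mat_mult_vec)
    qed (simp add: gram_mat_def)
    then have "vec n x = 0\<^sub>v n"
      using L det_0_iff_vec_prod_zero[OF gram_mat_carrier, of n I w] vec_carrier[of n x] by blast
    then have "vec n x $ i = 0\<^sub>v n $ i"
      by simp
    then show "x i = 0"
      using i by simp
  qed
next
  assume R: ?R
  show ?L
  proof
    assume "det (gram_mat n I w) = 0"
    then obtain v where v: "v \<in> carrier_vec n" "v \<noteq> 0\<^sub>v n" "gram_mat n I w *\<^sub>v v = 0\<^sub>v n"
      using det_0_iff_vec_prod_zero[OF gram_mat_carrier, of n I w] by auto
    \<comment> \<open>With y = W v, the sum of squares of the entries of y is v^T (W^T W v), hence
      zero.\<close>
    define y where "y r = (\<Sum>j<n. w r j * v $ j)" for r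
    have "(\<Sum>r\<in>I. y r * y r) = (\<Sum>r\<in>I. \<Sum>i<n. v $ i * (w r i * y r))"
      by (simp add: y_def[of _] sum_distrib_right[of _ _ "y _", folded y_def] sum_distrib_left ac_simps)
    also have "\<dots> = (\<Sum>i<n. v $ i * (\<Sum>r\<in>I. w r i * y r))"
      by (subst sum.swap) (simp add: sum_distrib_left)
    also have "\<dots> = (\<Sum>i<n. v $ i * (gram_mat n I w *\<^sub>v v) $ i)"
      using v(1) by (simp add: gram_mat_mult_vec y_def)
    also have "\<dots> = 0"
      by (simp add: v(3))
    finally have "\<forall>r\<in>I. y r = 0"
      using fin by (simp add: sum_nonneg_eq_0_iff)
    then have "\<forall>i<n. v $ i = 0"
      using R by (simp add: y_def)
    then have "v = 0\<^sub>v n"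
      using v(1) by (intro eq_vecI) auto
    then show False
      using v(2) by simp
  qed
qed

section \<open>Closure properties of polynomial functions\<close>

lemma polynomial_functions_sum:
  "(\<And>a. a \<in> A \<Longrightarrow> (\<lambda>\<Phi>. f a \<Phi>) \<in> polynomial_functions n t) \<Longrightarrow>
    (\<lambda>\<Phi>. \<Sum>a\<in>A. f a \<Phi>) \<in> polynomial_functions n t"
  by (induction A rule: infinite_finite_induct) (auto intro: polynomial_functions.intros)

lemma polynomial_functions_prod:
  "(\<And>a. a \<in> A \<Longrightarrow> (\<lambda>\<Phi>. f a \<Phi>) \<in> polynomial_functions n t) \<Longrightarrow>
    (\<lambda>\<Phi>. \<Prod>a\<in>A. f a \<Phi>) \<in> polynomial_functions n t"
  by (induction A rule: infinite_finite_induct) (auto intro: polynomial_functions.intros)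

lemma polynomial_functions_det:
  assumes "\<And>i j. i < k \<Longrightarrow> j < k \<Longrightarrow> (\<lambda>\<Phi>. F \<Phi> (i, j)) \<in> polynomial_functions n t"
  shows "(\<lambda>\<Phi>. det (mat k k (F \<Phi>))) \<in> polynomial_functions n t"
proof -
  \<comment> \<open>The Leibniz formula writes the determinant as a sum of products of
    entries.\<close>
  have "det (mat k k (F \<Phi>)) =
    (\<Sum>p\<in>{p. p permutes {0..<k}}. signof p * (\<Prod>i = 0..<k. F \<Phi> (i, p i)))" for \<Phi>
    by (subst det_def'[of _ k]) (auto intro!: sum.cong prod.cong simp: permutes_in_image)
  moreover have "(\<lambda>\<Phi>. F \<Phi> (i, p i)) \<in> polynomial_functions n t"
    if "p \<in> {p. p permutes {0..<k}}" "i \<in> {0..<k}" for p and i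
    using that assms permutes_in_image[of p "{0..<k}" i] by simp
  ultimately show ?thesis
    by (simp only:) (intro polynomial_functions_sum polynomial_functions_prod
        polynomial_functions.mult polynomial_functions.const)
qed

text \<open>All rows of all forms; when \<open>t = 1\<close> and \<open>n\<close> is odd, where an alternating form is always
  degenerate, the last unit vector is added.\<close>

definition form_row_index :: "nat \<Rightarrow> nat \<Rightarrow> (nat \<times> nat) set" where
  "form_row_index n t = {..<t} \<times> {..<n} \<union> (if t = 1 \<and> odd n then {(t, 0)} else {})"

definition form_row :: "nat \<Rightarrow> nat \<Rightarrow> 'a :: comm_ring_1 mat list \<Rightarrow> nat \<times> nat \<Rightarrow> nat \<Rightarrow> 'a" where
  "form_row n t \<Phi> = (\<lambda>(m, k) i. if m < t then (\<Phi> ! m) $$ (k, i) else if Suc i = n then 1 else 0)"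

text \<open>The zero set of this function serves as the exceptional closed set, except when
  \<open>n = 1\<close> and \<open>t > 1\<close>.\<close>

definition kernel_poly :: "nat \<Rightarrow> nat \<Rightarrow> rat mat list \<Rightarrow> rat" where
  "kernel_poly n t \<Phi> = det (gram_mat n (form_row_index n t) (form_row n t \<Phi>))"

lemma kernel_poly_polynomial: "kernel_poly n t \<in> polynomial_functions n t"
proof -
  have row: "(\<lambda>\<Phi>. form_row n t \<Phi> r i) \<in> polynomial_functions n t"
    if "r \<in> form_row_index n t" "i < n" for r i
    using that unfolding form_row_def form_row_index_def
    by (cases r; cases "fst r < t"; cases "Suc i = n") (auto intro: polynomial_functions.intros split: if_splits)
  show ?thesis
    unfolding kernel_poly_def[abs_def] gram_mat_def
    by (rule polynomial_functions_det)
      (auto intro!: polynomial_functions_sum polynomial_functions.mult row)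
qed

lemma kernel_poly_nonzero_iff:
  "kernel_poly n t \<Phi> \<noteq> 0 \<longleftrightarrow>
    (\<forall>x. (\<forall>m<t. \<forall>k<n. (\<Sum>i<n. (\<Phi> ! m) $$ (k, i) * x i) = 0) \<longrightarrow>
      (t = 1 \<and> odd n \<longrightarrow> x (n - 1) = 0) \<longrightarrow> (\<forall>i<n. x i = 0))"
proof -
  have fin: "finite (form_row_index n t)"
    by (simp add: form_row_index_def)
  \<comment> \<open>Odd \<open>n\<close> is positive, so \<open>n - 1\<close> is a genuine index and
    the extra row reads off that coordinate.\<close>
  have last: "(\<Sum>i<n. (if Suc i = n then 1 else 0) * x i) = x (n - 1)" if "odd n" for x :: "nat \<Rightarrow> rat"
    using that by (cases n) (auto simp: if_distrib[of "\<lambda>u. u * _"] cong: if_cong)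
  have "(\<forall>r\<in>form_row_index n t. (\<Sum>i<n. form_row n t \<Phi> r i * x i) = 0) \<longleftrightarrow>
    (\<forall>m<t. \<forall>k<n. (\<Sum>i<n. (\<Phi> ! m) $$ (k, i) * x i) = 0) \<and> (t = 1 \<and> odd n \<longrightarrow> x (n - 1) = 0)" for x
    using last[of x] by (auto simp: form_row_index_def form_row_def)
  then show ?thesis
    unfolding kernel_poly_def det_gram_mat_nonzero_iff[OF fin] by (simp only: imp_conjL)
qed

text \<open>Group elements have integer coordinates while the polynomial lives over the rationals,
  so the integer system is first embedded into the rational one.\<close>

lemma kernel_poly_nonzeroD:
  fixes x :: "nat \<Rightarrow> int"
  assumes \<Phi>: "\<Phi> \<in> alt_tuples n t" and nz: "kernel_poly n t (rat_tuple \<Phi>) \<noteq> 0"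
    and x: "\<And>m k. m < t \<Longrightarrow> k < n \<Longrightarrow> (\<Sum>i<n. (\<Phi> ! m) $$ (k, i) * x i) = 0"
    and last: "t = 1 \<Longrightarrow> odd n \<Longrightarrow> x (n - 1) = 0" and i: "i < n"
  shows "x i = 0"
proof -
  have "(\<Sum>i<n. (rat_tuple \<Phi> ! m) $$ (k, i) * rat_of_int (x i)) = 0" if "m < t" "k < n" for m k
  proof -
    have "\<Phi> ! m \<in> carrier_mat n n"
      using \<Phi> that by (force simp: alt_tuples_def alt_forms_def)
    then have "(\<Sum>i<n. (rat_tuple \<Phi> ! m) $$ (k, i) * rat_of_int (x i)) =
      rat_of_int (\<Sum>i<n. (\<Phi> ! m) $$ (k, i) * x i)"
      using \<Phi> that by (simp add: alt_tuples_def)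
    then show ?thesis
      using x that by simp
  qed
  then have "rat_of_int (x i) = 0"
    using nz i last unfolding kernel_poly_nonzero_iff by (auto dest!: spec[of _ "\<lambda>i. rat_of_int (x i)"])
  then show ?thesis
    by simp
qed

text \<open>The first form pairs the basis vectors \<open>2i\<close> and \<open>2i + 1\<close>, so it only misses the last basis
  vector for odd \<open>n\<close>; the second form takes care of that vector by pairing it with the first one.\<close>

lemma kernel_poly_nonzero_exists:
  assumes t: "t > 0" and n: "t = 1 \<or> n > 1"
  shows "\<exists>\<Phi>\<in>alt_tuples n t. kernel_poly n t \<Phi> \<noteq> 0"
proof -
  define A :: "rat mat" where "A = mat n n (\<lambda>(i, j).
    if even i \<and> j = Suc i then 1 else if even j \<and> i = Suc j then - 1 else 0)"
  \<comment> \<open>For \<open>n = 1\<close> the two corner positions coincide on the diagonal; the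
    guard \<open>n > 1\<close> keeps \<open>B\<close> alternating there.\<close>
  define B :: "rat mat" where "B = mat n n (\<lambda>(i, j). if i = 0 \<and> Suc j = n \<and> n > 1 then 1
    else if j = 0 \<and> Suc i = n \<and> n > 1 then - 1 else 0)"
  define \<Phi> where "\<Phi> = map (\<lambda>m. if m = 0 then A else B) [0..<t]"
  have "A \<in> alt_forms n"
    by (auto simp: A_def alt_forms_def)
  moreover have "B \<in> alt_forms n"
    by (auto simp: B_def alt_forms_def)
  ultimately have "\<Phi> \<in> alt_tuples n t"
    by (auto simp: \<Phi>_def alt_tuples_def)
  moreover have "kernel_poly n t \<Phi> \<noteq> 0"
    unfolding kernel_poly_nonzero_iff
  proof (intro allI impI)
    fix x i
    assume x: "\<forall>m<t. \<forall>k<n. (\<Sum>i<n. (\<Phi> ! m) $$ (k, i) * x i) = 0"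
      and last: "t = 1 \<and> odd n \<longrightarrow> x (n - 1) = 0" and i: "i < n"
    have A: "(\<Sum>i<n. A $$ (k, i) * x i) = 0" if "k < n" for k
      using x[rule_format, OF t that] t by (simp add: \<Phi>_def)
    show "x i = 0"
    proof (cases "odd i")
      case True
      then obtain j where j: "i = Suc j" "even j"
        by (cases i) auto
      \<comment> \<open>For even \<open>j\<close> the only nonzero entry of row \<open>j\<close> is
        in column \<open>j + 1\<close>, which is \<open>i\<close>.\<close>
      have "(\<Sum>k<n. A $$ (j, k) * x k) = (\<Sum>k<n. if k = i then x i else 0)"
        using i j by (intro sum.cong) (auto simp: A_def)
      then show ?thesis
        using A[of j] i j by simp
    next
      case even: False
      show ?thesis
      proof (cases "Suc i < n")
        case True
        \<comment> \<open>The row after an even \<open>i\<close> has its only nonzero entry, -1, in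
          column \<open>i\<close>.\<close>
        have "(\<Sum>k<n. A $$ (Suc i, k) * x k) = (\<Sum>k<n. if k = i then - x i else 0)"
          using True even by (intro sum.cong) (auto simp: A_def)
        then show ?thesis
          using A[of "Suc i"] True by simp
      next
        case False
        then have i_eq: "Suc i = n"
          using i by simp
        show ?thesis
        \<comment> \<open>Only the last coordinate for odd \<open>n\<close> remains: the extra row
          controls it when \<open>t = 1\<close>, row 0 of \<open>B\<close> otherwise.\<close>
        proof (cases "t = 1")
          case True
          then show ?thesis
            using last i_eq even by auto
        next
          case False
          then have "n > 1" "t > 1"
            using n t by auto
          have "(\<Sum>k<n. B $$ (0, k) * x k) = 0"
            using x[rule_format, of 1 0] \<open>n > 1\<close> \<open>t > 1\<close> by (simp add: \<Phi>_def)
          moreover have "(\<Sum>k<n. B $$ (0, k) * x k) = (\<Sum>k<n. if k = i then x i else 0)"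
            using \<open>n > 1\<close> i_eq by (intro sum.cong) (auto simp: B_def)
          ultimately show ?thesis
            using i by simp
        qed
      qed
    qed
  qed
  ultimately show ?thesis
    by blast
qed

lemma rat_tuple_alt_tuples:
  assumes "\<Phi> \<in> alt_tuples n t"
  shows "rat_tuple \<Phi> \<in> alt_tuples n t"
proof -
  have "map_mat rat_of_int A \<in> alt_forms n" if A: "A \<in> alt_forms n" for A
  proof -
    have carrier: "A \<in> carrier_mat n n" and diag: "\<And>i. i < n \<Longrightarrow> A $$ (i, i) = 0"
      and skew: "\<And>i j. i < n \<Longrightarrow> j < n \<Longrightarrow> A $$ (i, j) = - A $$ (j, i)"
      using A unfolding alt_forms_def by blast+
    show ?thesis
      unfolding alt_forms_def mem_Collect_eq
    proof (intro conjI allI impI)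
      fix i j assume "i < n" "j < n"
      then show "map_mat rat_of_int A $$ (i, j) = - map_mat rat_of_int A $$ (j, i)"
        using carrier skew[of i j] by simp
    qed (use carrier diag in auto)
  qed
  then show ?thesis
    using assms by (auto simp: alt_tuples_def)
qed

text \<open>An alternating form on Z is zero, so a nonempty tuple of such forms is
  dependent.\<close>

lemma P_tuples_1_empty: "t > 0 \<Longrightarrow> P_tuples 1 t = {}"
proof (rule equals0I)
  fix \<Phi> assume t: "t > 0" and "\<Phi> \<in> P_tuples 1 t"
  then have alt: "length \<Phi> = t" "set \<Phi> \<subseteq> alt_forms 1" and ind: "lin_indep_tuple 1 t (rat_tuple \<Phi>)"
    by (auto simp: P_tuples_def alt_tuples_def)
  have "(rat_tuple \<Phi> ! m) $$ (0, 0) = 0" if "m < t" for m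
  proof -
    have "\<Phi> ! m \<in> alt_forms 1"
      using alt that by (auto simp: subset_iff)
    then show ?thesis
      using alt that by (auto simp: alt_forms_def)
  qed
  then have "(1 :: rat) = 0"
    using ind[unfolded lin_indep_tuple_def, rule_format, of "\<lambda>_. 1" 0] t by simp
  then show False
    by simp
qed

section \<open>The group of a tuple of forms\<close>

text \<open>The 2-cocycle of the central extension of Z^n by Z^t. Being bilinear, it satisfies the
  cocycle identity needed for associativity.\<close>

definition twist :: "nat \<Rightarrow> nat \<Rightarrow> int mat list \<Rightarrow> int vec \<Rightarrow> int vec \<Rightarrow> int vec" where
  "twist n t \<Phi> k p = vec t (\<lambda>m. \<Sum>i<n. \<Sum>j<i. k $ i * p $ j * (\<Phi> ! m) $$ (i, j))"

text \<open>For alternating forms this is the commutator map: \<open>pairing\<close> of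
  \<open>k\<close> and \<open>p\<close> is the second component of the commutator of any lifts of
  \<open>k\<close> and \<open>p\<close>.\<close>

definition pairing :: "nat \<Rightarrow> nat \<Rightarrow> int mat list \<Rightarrow> int vec \<Rightarrow> int vec \<Rightarrow> int vec" where
  "pairing n t \<Phi> k p = vec t (\<lambda>m. \<Sum>i<n. \<Sum>j<n. k $ i * p $ j * (\<Phi> ! m) $$ (i, j))"

lemma twist_carrier [simp]: "twist n t \<Phi> k p \<in> carrier_vec t"
  and pairing_carrier [simp]: "pairing n t \<Phi> k p \<in> carrier_vec t"
  by (simp_all add: twist_def pairing_def)

lemma twist_dim [simp]: "dim_vec (twist n t \<Phi> k p) = t"
  by (simp add: twist_def)

lemma twist_add_left:
  "k \<in> carrier_vec n \<Longrightarrow> p \<in> carrier_vec n \<Longrightarrow>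
    twist n t \<Phi> (k + p) s = twist n t \<Phi> k s + twist n t \<Phi> p s"
  by (auto simp: twist_def distrib_right sum.distrib)

lemma twist_add_right:
  "p \<in> carrier_vec n \<Longrightarrow> s \<in> carrier_vec n \<Longrightarrow>
    twist n t \<Phi> k (p + s) = twist n t \<Phi> k p + twist n t \<Phi> k s"
  by (auto simp: twist_def distrib_right distrib_left sum.distrib)

lemma twist_zero_left [simp]: "twist n t \<Phi> (0\<^sub>v n) p = 0\<^sub>v t"
  by (auto simp: twist_def)

lemma twist_zero_right [simp]: "twist n t \<Phi> k (0\<^sub>v n) = 0\<^sub>v t"
  by (auto simp: twist_def)

lemma twist_uminus_left:
  "k \<in> carrier_vec n \<Longrightarrow> twist n t \<Phi> (- k) p = - twist n t \<Phi> k p"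
  by (auto simp: twist_def sum_negf)

text \<open>The part above the diagonal is, by skew-symmetry, minus the part below it with
  \<open>k\<close> and \<open>p\<close> exchanged. Induction on \<open>n\<close> adds one row and
  one column at a time.\<close>

lemma alternating_sum_split:
  fixes a :: "nat \<Rightarrow> nat \<Rightarrow> 'a :: comm_ring_1"
  assumes "\<And>i. i < n \<Longrightarrow> a i i = 0" and "\<And>i j. i < n \<Longrightarrow> j < n \<Longrightarrow> a i j = - a j i"
  shows "(\<Sum>i<n. \<Sum>j<n. k i * p j * a i j) =
    (\<Sum>i<n. \<Sum>j<i. k i * p j * a i j) - (\<Sum>i<n. \<Sum>j<i. p i * k j * a i j)"
  using assms
proof (induction n)
  case 0
  show ?case
    by simp
next
  case (Suc n)
  have "(\<Sum>i<n. k i * p n * a i n) = (\<Sum>j<n. - (p n * k j * a n j))"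
  proof (rule sum.cong)
    fix i assume "i \<in> {..<n}"
    then have "a i n = - a n i"
      by (intro Suc.prems(2)) auto
    then show "k i * p n * a i n = - (p n * k i * a n i)"
      by simp
  qed simp
  moreover have "a n n = 0"
    by (rule Suc.prems(1)) simp
  moreover have "(\<Sum>i<n. \<Sum>j<n. k i * p j * a i j) =
    (\<Sum>i<n. \<Sum>j<i. k i * p j * a i j) - (\<Sum>i<n. \<Sum>j<i. p i * k j * a i j)"
    by (rule Suc.IH; rule Suc.prems) simp_all
  ultimately show ?case
    by (simp add: sum.distrib sum_negf)
qed

lemma sum_unit_vec:
  fixes b :: "nat \<Rightarrow> 'a :: semiring_1"
  assumes "i < n"
  shows "(\<Sum>j<n. unit_vec n i $ j * b j) = b i"
  using assms by (simp add: unit_vec_def if_distrib[of "\<lambda>u. u * _"] cong: if_cong)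

text \<open>Exchanging the factors of a product in the group changes only the \<open>twist\<close>
  term, so this difference measures noncommutativity.\<close>

lemma twist_minus_twist:
  assumes "\<Phi> \<in> alt_tuples n t"
  shows "twist n t \<Phi> k p - twist n t \<Phi> p k = pairing n t \<Phi> k p"
proof (rule eq_vecI)
  fix m assume "m < dim_vec (pairing n t \<Phi> k p)"
  then have m: "m < t"
    by (simp add: pairing_def)
  then have "\<Phi> ! m \<in> alt_forms n"
    using assms by (auto simp: alt_tuples_def subset_iff)
  then have "(\<Phi> ! m) $$ (i, i) = 0" "(\<Phi> ! m) $$ (i, j) = - (\<Phi> ! m) $$ (j, i)"
    if "i < n" "j < n" for i j
    using that unfolding alt_forms_def by blast+
  note split = alternating_sum_split[of n "\<lambda>i j. (\<Phi> ! m) $$ (i, j)", OF this]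
  show "(twist n t \<Phi> k p - twist n t \<Phi> p k) $ m = pairing n t \<Phi> k p $ m"
    using m by (simp add: twist_def pairing_def split)
qed (simp add: pairing_def)

lemma carrier_form_group [simp]: "carrier (form_group n t \<Phi>) = carrier_vec n \<times> carrier_vec t"
  by (simp add: form_group_def)

lemma one_form_group [simp]: "\<one>\<^bsub>form_group n t \<Phi>\<^esub> = (0\<^sub>v n, 0\<^sub>v t)"
  by (simp add: form_group_def)

lemma mult_form_group [simp]:
  "(k, l) \<otimes>\<^bsub>form_group n t \<Phi>\<^esub> (p, q) = (k + p, l + q + twist n t \<Phi> k p)"
  by (simp add: form_group_def twist_def)

lemma group_form_group: "group (form_group n t \<Phi>)"
proof (rule groupI)
  fix x y z
  assume "x \<in> carrier (form_group n t \<Phi>)" "y \<in> carrier (form_group n t \<Phi>)"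
    "z \<in> carrier (form_group n t \<Phi>)"
  then show "x \<otimes>\<^bsub>form_group n t \<Phi>\<^esub> y \<otimes>\<^bsub>form_group n t \<Phi>\<^esub> z =
    x \<otimes>\<^bsub>form_group n t \<Phi>\<^esub> (y \<otimes>\<^bsub>form_group n t \<Phi>\<^esub> z)"
    by (cases x; cases y; cases z)
      (auto simp: twist_add_left twist_add_right)
next
  fix x assume "x \<in> carrier (form_group n t \<Phi>)"
  then obtain k l where x: "x = (k, l)" and kl: "k \<in> carrier_vec n" "l \<in> carrier_vec t"
    by auto
  show "\<exists>y\<in>carrier (form_group n t \<Phi>). y \<otimes>\<^bsub>form_group n t \<Phi>\<^esub> x = \<one>\<^bsub>form_group n t \<Phi>\<^esub>"
    \<comment> \<open>The term \<open>twist n t \<Phi> k k\<close> cancels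
      \<open>twist n t \<Phi> (- k) k\<close>, which is its negative.\<close>
    using kl by (intro bexI[of _ "(- k, - l + twist n t \<Phi> k k)"])
      (auto simp: x twist_uminus_left)
qed auto

text \<open>Commuting with \<open>(p, q)\<close> means that \<open>pairing\<close> vanishes at
  \<open>k\<close> and \<open>p\<close>; by linearity it suffices to test unit vectors
  \<open>p\<close>. The index order \<open>(j, i)\<close> matches the rows entering
  \<open>kernel_poly\<close>.\<close>

lemma center_form_group_iff:
  assumes \<Phi>: "\<Phi> \<in> alt_tuples n t"
  shows "(k, l) \<in> center (form_group n t \<Phi>) \<longleftrightarrow> k \<in> carrier_vec n \<and> l \<in> carrier_vec t \<and>
    (\<forall>m<t. \<forall>j<n. (\<Sum>i<n. (\<Phi> ! m) $$ (j, i) * k $ i) = 0)" (is "_ \<longleftrightarrow> _ \<and> _ \<and> ?K")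
proof (cases "k \<in> carrier_vec n \<and> l \<in> carrier_vec t")
  case True
  have "(k, l) \<in> center (form_group n t \<Phi>) \<longleftrightarrow>
    (\<forall>p\<in>carrier_vec n. \<forall>q\<in>carrier_vec t. l + q + twist n t \<Phi> k p = q + l + twist n t \<Phi> p k)"
    using True by (auto simp: center_def comm_add_vec[of k n])
  also have "\<dots> \<longleftrightarrow> (\<forall>p\<in>carrier_vec n. twist n t \<Phi> k p - twist n t \<Phi> p k = 0\<^sub>v t)"
  proof -
    have "l + q + twist n t \<Phi> k p = q + l + twist n t \<Phi> p k \<longleftrightarrow> twist n t \<Phi> k p - twist n t \<Phi> p k = 0\<^sub>v t"
      if "q \<in> carrier_vec t" for p q
      using that True by (auto simp: vec_eq_iff)
    \<comment> \<open>The condition does not depend on \<open>q\<close>; a witness in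
      \<open>carrier_vec t\<close> is needed to drop that quantifier.\<close>
    moreover have "0\<^sub>v t \<in> carrier_vec t"
      by simp
    ultimately show ?thesis
      by blast
  qed
  also have "\<dots> \<longleftrightarrow> (\<forall>p\<in>carrier_vec n. pairing n t \<Phi> k p = 0\<^sub>v t)"
    by (simp add: twist_minus_twist[OF \<Phi>])
  also have "\<dots> \<longleftrightarrow> ?K"
  proof -
    \<comment> \<open>The sign comes from skew-symmetry, which turns columns of the forms into
      rows.\<close>
    have pair: "pairing n t \<Phi> k p $ m = - (\<Sum>j<n. p $ j * (\<Sum>i<n. (\<Phi> ! m) $$ (j, i) * k $ i))"
      if "m < t" for p m
    proof -
      have "\<Phi> ! m \<in> alt_forms n"
        using \<Phi> that by (auto simp: alt_tuples_def subset_iff)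
      then have skew: "(\<Phi> ! m) $$ (i, j) = - (\<Phi> ! m) $$ (j, i)" if "i < n" "j < n" for i j
        using that unfolding alt_forms_def by blast
      have "pairing n t \<Phi> k p $ m = (\<Sum>j<n. \<Sum>i<n. k $ i * p $ j * (\<Phi> ! m) $$ (i, j))"
        using that by (simp add: pairing_def) (rule sum.swap)
      also have "\<dots> = (\<Sum>j<n. \<Sum>i<n. - (p $ j * ((\<Phi> ! m) $$ (j, i) * k $ i)))"
      proof (intro sum.cong refl)
        fix j i assume "j \<in> {..<n}" "i \<in> {..<n}"
        then have "(\<Phi> ! m) $$ (i, j) = - (\<Phi> ! m) $$ (j, i)"
          using skew by blast
        then show "k $ i * p $ j * (\<Phi> ! m) $$ (i, j) = - (p $ j * ((\<Phi> ! m) $$ (j, i) * k $ i))"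
          by simp
      qed
      finally show ?thesis
        by (simp add: sum_negf sum_distrib_left)
    qed
    show ?thesis
    proof
      assume *: "\<forall>p\<in>carrier_vec n. pairing n t \<Phi> k p = 0\<^sub>v t"
      show ?K
      proof (intro allI impI)
        fix m j assume m: "m < t" and j: "j < n"
        have "pairing n t \<Phi> k (unit_vec n j) $ m = 0\<^sub>v t $ m"
          using * by simp
        then show "(\<Sum>i<n. (\<Phi> ! m) $$ (j, i) * k $ i) = 0"
          using m by (simp add: pair sum_unit_vec[OF j])
      qed
    next
      assume ?K
      then show "\<forall>p\<in>carrier_vec n. pairing n t \<Phi> k p = 0\<^sub>v t"
        by (auto simp: pair pairing_def[THEN arg_cong[of _ _ dim_vec]])
    qed
  qed
  finally show ?thesis
    using True by simp
qed (auto simp: center_def)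

section \<open>The commutator subgroup of G(\<Phi>) and its isolator\<close>

lemma form_group_pow_zero_left:
  "l \<in> carrier_vec t \<Longrightarrow> (0\<^sub>v n, l) [^]\<^bsub>form_group n t \<Phi>\<^esub> r = (0\<^sub>v n, int r \<cdot>\<^sub>v l)" for r :: nat
  by (induction r) (auto simp: algebra_simps)

lemma form_group_pow_fst:
  assumes "x \<in> carrier (form_group n t \<Phi>)"
  shows "fst (x [^]\<^bsub>form_group n t \<Phi>\<^esub> (r :: nat)) = int r \<cdot>\<^sub>v fst x"
proof -
  obtain k l where x: "x = (k, l)" "k \<in> carrier_vec n"
    using assms by auto
  have "fst (y \<otimes>\<^bsub>form_group n t \<Phi>\<^esub> x) = fst y + k" for y
    by (cases y) (simp add: x)
  then show ?thesis
    using x by (induction r) (auto simp: algebra_simps)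
qed

text \<open>This element is the commutator of \<open>(k, 0)\<close> and \<open>(p, 0)\<close>: its
  first component is zero, so multiplying by it adds no twist and simply corrects yx to xy.\<close>

lemma pairing_in_commutator_subgroup:
  assumes \<Phi>: "\<Phi> \<in> alt_tuples n t" and kp: "k \<in> carrier_vec n" "p \<in> carrier_vec n"
  shows "(0\<^sub>v n, pairing n t \<Phi> k p) \<in> commutator_subgroup (form_group n t \<Phi>)"
proof -
  let ?G = "form_group n t \<Phi>"
  interpret group ?G
    by (rule group_form_group)
  define x y where "x = (k, 0\<^sub>v t :: int vec)" and "y = (p, 0\<^sub>v t :: int vec)"
  have xy: "x \<in> carrier ?G" "y \<in> carrier ?G"
    using kp by (auto simp: x_def y_def)
  have c: "(0\<^sub>v n, pairing n t \<Phi> k p) \<in> carrier ?G"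
    by simp
  have "(0\<^sub>v n, pairing n t \<Phi> k p) \<otimes>\<^bsub>?G\<^esub> (y \<otimes>\<^bsub>?G\<^esub> x) = x \<otimes>\<^bsub>?G\<^esub> y"
    using kp by (auto simp: x_def y_def twist_minus_twist[OF \<Phi>, symmetric])
  then have "(0\<^sub>v n, pairing n t \<Phi> k p) = x \<otimes>\<^bsub>?G\<^esub> y \<otimes>\<^bsub>?G\<^esub> inv\<^bsub>?G\<^esub> (y \<otimes>\<^bsub>?G\<^esub> x)"
    using xy c by (metis inv_solve_right m_closed)
  also have "\<dots> = x \<otimes>\<^bsub>?G\<^esub> y \<otimes>\<^bsub>?G\<^esub> inv\<^bsub>?G\<^esub> x \<otimes>\<^bsub>?G\<^esub> inv\<^bsub>?G\<^esub> y"
    using xy by (simp add: inv_mult_group m_assoc del: carrier_form_group)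
  finally show ?thesis
    unfolding derived_def using xy by (auto intro!: generate.incl)
qed

text \<open>The first projection is a homomorphism to the abelian group Z^n, so it kills
  commutators.\<close>

lemma commutator_subgroup_form_group_subset:
  "commutator_subgroup (form_group n t \<Phi>) \<subseteq> {0\<^sub>v n} \<times> carrier_vec t"
proof -
  let ?G = "form_group n t \<Phi>"
  interpret group ?G
    by (rule group_form_group)
  have sub: "subgroup ({0\<^sub>v n} \<times> carrier_vec t) ?G"
  proof (rule subgroupI)
    fix x :: "int vec \<times> int vec" assume "x \<in> {0\<^sub>v n} \<times> carrier_vec t"
    then obtain l where x: "x = (0\<^sub>v n, l)" "l \<in> carrier_vec t"
      by auto
    have "inv\<^bsub>?G\<^esub> x = (0\<^sub>v n, - l)"
      using x by (intro inv_equality) auto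
    then show "inv\<^bsub>?G\<^esub> x \<in> {0\<^sub>v n} \<times> carrier_vec t"
      using x by simp
  next
    show "{0\<^sub>v n :: int vec} \<times> (carrier_vec t :: int vec set) \<noteq> {}"
      using zero_carrier_vec[of t] by blast
  qed auto
  have "fst (x \<otimes>\<^bsub>?G\<^esub> y \<otimes>\<^bsub>?G\<^esub> inv\<^bsub>?G\<^esub> x \<otimes>\<^bsub>?G\<^esub> inv\<^bsub>?G\<^esub> y) = 0\<^sub>v n"
    if "x \<in> carrier ?G" "y \<in> carrier ?G" for x y
  proof -
    have fst_mult: "fst (u \<otimes>\<^bsub>?G\<^esub> v) = fst u + fst v" for u v
      by (cases u; cases v) simp
    have inv: "fst (inv\<^bsub>?G\<^esub> u) = - fst u" if "u \<in> carrier ?G" for u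
    proof -
      have "fst (inv\<^bsub>?G\<^esub> u) + fst u = 0\<^sub>v n"
        using l_inv[OF that] fst_mult[of "inv\<^bsub>?G\<^esub> u" u] by simp
      moreover have "fst u \<in> carrier_vec n" "fst (inv\<^bsub>?G\<^esub> u) \<in> carrier_vec n"
        using that inv_closed[OF that] by (auto simp del: inv_closed)
      ultimately show ?thesis
        by (auto simp: vec_eq_iff eq_neg_iff_add_eq_0)
    qed
    show ?thesis
      using that by (auto simp: fst_mult inv)
  qed
  then have fst_comm: "fst c = 0\<^sub>v n" if "c \<in> derived_set ?G (carrier ?G)" for c
    using that by (simp del: carrier_form_group) blast
  have "derived_set ?G (carrier ?G) \<subseteq> {0\<^sub>v n} \<times> carrier_vec t"
  proof
    fix c assume c: "c \<in> derived_set ?G (carrier ?G)"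
    then have "c \<in> carrier_vec n \<times> carrier_vec t"
      using derived_set_in_carrier[OF order_refl] unfolding carrier_form_group by blast
    then show "c \<in> {0\<^sub>v n} \<times> carrier_vec t"
      using fst_comm[OF c] by (cases c) simp
  qed
  then show ?thesis
    unfolding derived_def using sub by (rule generate_subgroup_incl)
qed

text \<open>An element with a positive power in G' has first component zero because Z^n is
  torsion-free. Conversely, independence of the forms makes the second components in G' span Q^t,
  and Cramer's rule yields a positive multiple of any \<open>l\<close> among them.\<close>

lemma isolator_commutator_subgroup_form_group:
  assumes P: "\<Phi> \<in> P_tuples n t"
  shows "isolator (form_group n t \<Phi>) (commutator_subgroup (form_group n t \<Phi>)) = {0\<^sub>v n} \<times> carrier_vec t"
    (is "isolator ?G ?D = _")
proof (rule equalityI)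
  show "isolator ?G ?D \<subseteq> {0\<^sub>v n} \<times> carrier_vec t"
  proof
    fix x assume "x \<in> isolator ?G ?D"
    then obtain r :: nat where x: "x \<in> carrier ?G" and r: "r \<ge> 1" "x [^]\<^bsub>?G\<^esub> r \<in> ?D"
      by (auto simp: isolator_def)
    have "fst (x [^]\<^bsub>?G\<^esub> r) = 0\<^sub>v n"
      using r(2) commutator_subgroup_form_group_subset by fastforce
    then have "int r \<cdot>\<^sub>v fst x = 0\<^sub>v n"
      using form_group_pow_fst[OF x] by simp
    then have "fst x = 0\<^sub>v n"
      using x r(1) by (auto simp: vec_eq_iff)
    then show "x \<in> {0\<^sub>v n} \<times> carrier_vec t"
      using x by (cases x) auto
  qed
next
  interpret group ?G
    by (rule group_form_group)
  interpret D: subgroup ?D ?G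
    by (rule derived_is_subgroup) simp
  have \<Phi>: "\<Phi> \<in> alt_tuples n t"
    using P by (simp add: P_tuples_def)
  \<comment> \<open>The second components of elements of G' form a Z-submodule of Z^t.\<close>
  have D_add: "(0\<^sub>v n, l + q) \<in> ?D" if "(0\<^sub>v n, l) \<in> ?D" "(0\<^sub>v n, q) \<in> ?D" for l q
  proof -
    have "l \<in> carrier_vec t" "q \<in> carrier_vec t"
      using that D.subset by auto
    then have "l + q + 0\<^sub>v t = l + q"
      by auto
    then show ?thesis
      using D.m_closed[OF that] by simp
  qed
  have D_uminus: "(0\<^sub>v n, - l) \<in> ?D" if "(0\<^sub>v n, l) \<in> ?D" for l
  proof -
    have "l \<in> carrier_vec t"
      using that D.subset by auto
    then have "inv\<^bsub>?G\<^esub> (0\<^sub>v n, l) = (0\<^sub>v n, - l)"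
      by (intro inv_equality) auto
    then show ?thesis
      using D.m_inv_closed[OF that] by simp
  qed
  have D_zero: "(0\<^sub>v n, 0\<^sub>v t) \<in> ?D"
    using D.one_closed by simp
  have D_smult: "(0\<^sub>v n, z \<cdot>\<^sub>v l) \<in> ?D" if l: "(0\<^sub>v n, l) \<in> ?D" for z l
  proof -
    have nat: "(0\<^sub>v n, int r \<cdot>\<^sub>v l) \<in> ?D" for r
    proof (induction r)
      case 0
      have "l \<in> carrier_vec t"
        using l D.subset by auto
      then have "int 0 \<cdot>\<^sub>v l = 0\<^sub>v t"
        by auto
      then show ?case
        using D_zero by simp
    next
      case (Suc r)
      have "int (Suc r) \<cdot>\<^sub>v l = int r \<cdot>\<^sub>v l + l"
        by (auto simp: algebra_simps)
      then show ?case
        using D_add[OF Suc l] by simp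
    qed
    show ?thesis
    proof (cases z rule: int_cases2)
      case (nonpos r)
      then have "z \<cdot>\<^sub>v l = - (int r \<cdot>\<^sub>v l)"
        by auto
      then show ?thesis
        using D_uminus[OF nat[of r]] by simp
    qed (use nat in auto)
  qed
  \<comment> \<open>The vector \<open>w (i, j)\<close> lists the values of all forms at the basis
    vectors \<open>i\<close> and \<open>j\<close>, that is, the commutator of these two
    generators.\<close>
  define w where "w = (\<lambda>(i, j) m. (\<Phi> ! m) $$ (i, j))"
  define I where "I = {..<n} \<times> {..<n}"
  have D_basic: "(0\<^sub>v n, vec t (w r)) \<in> ?D" if r: "r \<in> I" for r
  proof -
    obtain i j where ij: "r = (i, j)" "i < n" "j < n"
      using r by (auto simp: I_def)
    have "(\<Sum>i'<n. \<Sum>j'<n. unit_vec n i $ i' * unit_vec n j $ j' * a i' j') = a i j"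
      for a :: "nat \<Rightarrow> nat \<Rightarrow> int"
      by (simp add: mult.assoc sum_unit_vec[OF ij(2)] sum_unit_vec[OF ij(3)] flip: sum_distrib_left)
    then have "pairing n t \<Phi> (unit_vec n i) (unit_vec n j) = vec t (w r)"
      by (auto simp: pairing_def w_def ij)
    then show ?thesis
      using pairing_in_commutator_subgroup[OF \<Phi>, of "unit_vec n i" "unit_vec n j"] by simp
  qed
  have D_sum: "(0\<^sub>v n, vec t (\<lambda>m. \<Sum>r\<in>J. z r * w r m)) \<in> ?D" if "finite J" "J \<subseteq> I" for J z
    using that
  proof (induction J)
    case empty
    have "vec t (\<lambda>m. 0 :: int) = 0\<^sub>v t"
      by auto
    then show ?case
      using D_zero by simp
  next
    case (insert r J)
    have "vec t (\<lambda>m. \<Sum>r\<in>insert r J. z r * w r m) = z r \<cdot>\<^sub>v vec t (w r) + vec t (\<lambda>m. \<Sum>r\<in>J. z r * w r m)"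
      using insert by auto
    then show ?case
      using insert D_add D_smult D_basic by simp
  qed
  have fin: "finite I"
    by (simp add: I_def)
  define W where "W = gram_mat t I w"
  have W: "W \<in> carrier_mat t t"
    by (simp add: W_def)
  \<comment> \<open>A vector orthogonal to every \<open>w r\<close> is a linear relation among the
    forms.\<close>
  have "det W \<noteq> 0"
    unfolding W_def det_gram_mat_nonzero_iff[OF fin]
  proof (intro allI impI)
    fix x :: "nat \<Rightarrow> int" and m
    assume x: "\<forall>r\<in>I. (\<Sum>m<t. w r m * x m) = 0" and m: "m < t"
    have "(\<Sum>m<t. rat_of_int (x m) * (rat_tuple \<Phi> ! m) $$ (i, j)) = 0" if "i < n" "j < n" for i j
    proof -
      have "(\<Sum>m<t. rat_of_int (x m) * (rat_tuple \<Phi> ! m) $$ (i, j)) =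
        (\<Sum>m<t. rat_of_int (w (i, j) m * x m))"
      proof (intro sum.cong refl)
        fix m assume "m \<in> {..<t}"
        then have "m < length \<Phi>" "\<Phi> ! m \<in> carrier_mat n n"
          using \<Phi> by (force simp: alt_tuples_def alt_forms_def)+
        then show "rat_of_int (x m) * (rat_tuple \<Phi> ! m) $$ (i, j) = rat_of_int (w (i, j) m * x m)"
          using that by (simp add: w_def)
      qed
      also have "\<dots> = rat_of_int (\<Sum>m<t. w (i, j) m * x m)"
        by simp
      finally show ?thesis
        using x that by (simp add: I_def)
    qed
    then have "rat_of_int (x m) = 0"
      using P m unfolding P_tuples_def lin_indep_tuple_def
      by (auto dest!: spec[of _ "\<lambda>m. rat_of_int (x m)"])
    then show "x m = 0"
      by simp
  qed
  show "{0\<^sub>v n} \<times> carrier_vec t \<subseteq> isolator ?G ?D"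
  proof clarify
    fix l :: "int vec" assume l: "l \<in> carrier_vec t"
    define y where "y = adj_mat W *\<^sub>v l"
    have y: "y \<in> carrier_vec t"
      using adj_mat(1)[OF W] l by (simp add: y_def)
    \<comment> \<open>The adjugate solves W y = det(W) l over the integers, and W y is an integer
      combination of the \<open>w r\<close>.\<close>
    have "det W \<cdot>\<^sub>v l = (W * adj_mat W) *\<^sub>v l"
      using l by (intro eq_vecI) (simp_all add: adj_mat(2)[OF W])
    also have "\<dots> = W *\<^sub>v y"
      unfolding y_def by (rule assoc_mult_mat_vec[OF W adj_mat(1)[OF W] l])
    also have "\<dots> = vec t (\<lambda>m. \<Sum>r\<in>I. (\<Sum>j<t. w r j * y $ j) * w r m)"
    proof (rule eq_vecI)
      fix m assume "m < dim_vec (vec t (\<lambda>m. \<Sum>r\<in>I. (\<Sum>j<t. w r j * y $ j) * w r m))"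
      then show "(W *\<^sub>v y) $ m = vec t (\<lambda>m. \<Sum>r\<in>I. (\<Sum>j<t. w r j * y $ j) * w r m) $ m"
        unfolding W_def by (subst gram_mat_mult_vec[OF y]) (simp_all add: mult.commute)
    qed (use W in simp)
    finally have D: "(0\<^sub>v n, det W \<cdot>\<^sub>v l) \<in> ?D"
      using D_sum[OF fin order_refl, of "\<lambda>r. \<Sum>j<t. w r j * y $ j"] by simp
    \<comment> \<open>The isolator asks for a natural exponent, while the determinant may be
      negative.\<close>
    have eq: "int (nat \<bar>det W\<bar>) \<cdot>\<^sub>v l = sgn (det W) \<cdot>\<^sub>v (det W \<cdot>\<^sub>v l)"
    proof -
      have "int (nat \<bar>det W\<bar>) = sgn (det W) * det W"
        by (simp add: sgn_if)
      then show ?thesis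
        by (simp only: smult_smult_assoc)
    qed
    have "(0\<^sub>v n, l) [^]\<^bsub>?G\<^esub> nat \<bar>det W\<bar> \<in> ?D"
      unfolding form_group_pow_zero_left[OF l] eq by (rule D_smult[OF D])
    moreover have "nat \<bar>det W\<bar> \<ge> 1"
      using \<open>det W \<noteq> 0\<close> by simp
    ultimately show "(0\<^sub>v n, l) \<in> isolator ?G ?D"
      using l by (auto simp: isolator_def)
  qed
qed

section \<open>The center for tuples outside the exceptional set\<close>

lemma center_form_group_nondegenerate:
  assumes \<Phi>: "\<Phi> \<in> alt_tuples n t" and nz: "kernel_poly n t (rat_tuple \<Phi>) \<noteq> 0"
    and nt: "\<not> (t = 1 \<and> odd n)"
  shows "center (form_group n t \<Phi>) = {0\<^sub>v n} \<times> carrier_vec t"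
proof -
  have "(k, l) \<in> center (form_group n t \<Phi>) \<longleftrightarrow> k = 0\<^sub>v n \<and> l \<in> carrier_vec t" for k l
    unfolding center_form_group_iff[OF \<Phi>]
  proof safe
    assume k: "k \<in> carrier_vec n" and ker: "\<forall>m<t. \<forall>j<n. (\<Sum>i<n. (\<Phi> ! m) $$ (j, i) * k $ i) = 0"
    have "k $ i = 0" if "i < n" for i
      by (rule kernel_poly_nonzeroD[OF \<Phi> nz]) (use ker nt that in auto)
    then show "k = 0\<^sub>v n"
      using k by auto
  qed auto
  then show ?thesis
    by auto
qed

text \<open>Transposition gives det A = det(-A) = (-1)^n det A, which is -det A for odd
  \<open>n\<close>.\<close>

lemma det_alt_form_odd:
  fixes A :: "int mat"
  assumes A: "A \<in> alt_forms n" and n: "odd n"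
  shows "det A = 0"
proof -
  have carrier: "A \<in> carrier_mat n n"
    using A by (simp add: alt_forms_def)
  have "transpose_mat A = (- 1) \<cdot>\<^sub>m A"
  proof (rule eq_matI)
    fix i j assume "i < dim_row ((- 1) \<cdot>\<^sub>m A)" "j < dim_col ((- 1) \<cdot>\<^sub>m A)"
    then have ij: "i < n" "j < n"
      using carrier by auto
    then have "A $$ (j, i) = - A $$ (i, j)"
      using A unfolding alt_forms_def by blast
    then show "transpose_mat A $$ (i, j) = ((- 1) \<cdot>\<^sub>m A) $$ (i, j)"
      using carrier ij by simp
  qed (use carrier in auto)
  then have "det A = (- 1) ^ n * det A"
    using det_transpose[OF carrier] carrier det_smult[of "- 1" A] by simp
  then show ?thesis
    using n by simp
qed

text \<open>On the center \<open>twist\<close> is symmetric, hence its diagonal is a quadratic form that corrects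
  the second component to a homomorphism.\<close>

lemma ab_rank_center_form_group_odd:
  assumes \<Phi>: "\<Phi> \<in> alt_tuples n 1" and nz: "kernel_poly n 1 (rat_tuple \<Phi>) \<noteq> 0" and n: "odd n"
  shows "ab_rank ((form_group n 1 \<Phi>)\<lparr>carrier := center (form_group n 1 \<Phi>)\<rparr>) = 2"
    (is "ab_rank ?C = 2")
proof -
  let ?G = "form_group n 1 \<Phi>"
  interpret group ?G
    by (rule group_form_group)
  interpret C: comm_group ?C
    by (rule comm_group_center)
  note C_iff = center_form_group_iff[OF \<Phi>]
  \<comment> \<open>The extra unit row in \<open>kernel_poly\<close> makes the last coordinate
    injective on the kernel of the form.\<close>
  have kernel: "k = 0\<^sub>v n"
    if "(k, l) \<in> center ?G" "k $ (n - 1) = 0" for k l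
  proof -
    have k: "k \<in> carrier_vec n"
      and ker: "\<And>m j. m < 1 \<Longrightarrow> j < n \<Longrightarrow> (\<Sum>i<n. (\<Phi> ! m) $$ (j, i) * k $ i) = 0"
      using that unfolding C_iff by blast+
    have "k $ i = 0" if "i < n" for i
      by (rule kernel_poly_nonzeroD[OF \<Phi> nz]) (use ker \<open>k $ (n - 1) = 0\<close> that in auto)
    then show ?thesis
      using k by auto
  qed
  \<comment> \<open>The cross terms of \<open>twist\<close> at \<open>k + p\<close> add up to twice
    \<open>twist n 1 \<Phi> k p\<close> on the center; doubling \<open>l\<close> matches them
    without dividing by 2.\<close>
  define f g :: "int vec \<times> int vec \<Rightarrow> int"
    where "f = (\<lambda>(k, l). k $ (n - 1))" and "g = (\<lambda>(k, l). 2 * l $ 0 - twist n 1 \<Phi> k k $ 0)"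
  have n0: "n - 1 < n"
    using n by (cases n) auto
  have C_carrier: "k \<in> carrier_vec n" "l \<in> carrier_vec 1" if "(k, l) \<in> center ?G" for k l
    using that unfolding C_iff by blast+
  have f: "f \<in> hom ?C integer_group"
  proof (rule homI)
    fix x y assume "x \<in> carrier ?C" "y \<in> carrier ?C"
    then obtain k l p q where xy: "x = (k, l)" "y = (p, q)" "(k, l) \<in> center ?G" "(p, q) \<in> center ?G"
      by (cases x; cases y) simp
    then have "p \<in> carrier_vec n"
      using C_carrier(1) by blast
    then show "f (x \<otimes>\<^bsub>?C\<^esub> y) = f x \<otimes>\<^bsub>integer_group\<^esub> f y"
      using n0 by (simp add: xy(1,2) f_def)
  qed simp
  have "g ((k, l) \<otimes>\<^bsub>?G\<^esub> (p, q)) = g (k, l) + g (p, q)"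
    if c: "(k, l) \<in> center ?G" "(p, q) \<in> center ?G" for k l p q
  proof -
    have carrier: "k \<in> carrier_vec n" "p \<in> carrier_vec n" "l \<in> carrier_vec 1" "q \<in> carrier_vec 1"
      using c C_carrier by blast+
    have "l + q + twist n 1 \<Phi> k p = q + l + twist n 1 \<Phi> p k"
      using center_commute[OF c(1) center_carrier[OF c(2)]] by simp
    then have "(l + q + twist n 1 \<Phi> k p) $ 0 = (q + l + twist n 1 \<Phi> p k) $ 0"
      by simp
    then show ?thesis
      using carrier by (simp add: g_def twist_add_left twist_add_right)
  qed
  then have g: "g \<in> hom ?C integer_group"
    by (auto simp: hom_def)
  have "ab_rank ?C \<le> 2"
  proof (rule ab_rank_le_2[OF C.comm_group_axioms f g])
    fix x assume "x \<in> carrier ?C" and zero: "f x = 0" "g x = 0"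
    then obtain k l where x: "x = (k, l)" "(k, l) \<in> center ?G"
      by (cases x) auto
    have "k = 0\<^sub>v n"
      using kernel[OF x(2)] zero(1) by (simp add: f_def x(1))
    moreover have "l \<in> carrier_vec 1"
      using x(2) C_carrier by blast
    ultimately have "l = 0\<^sub>v 1"
      using zero(2) by (auto simp: g_def x(1))
    then show "x = \<one>\<^bsub>?C\<^esub>"
      using x(1) \<open>k = 0\<^sub>v n\<close> by simp
  qed
  moreover have "2 \<le> ab_rank ?C"
  proof -
    have A: "\<Phi> ! 0 \<in> alt_forms n"
      using \<Phi> by (auto simp: alt_tuples_def subset_iff)
    then have Ac: "\<Phi> ! 0 \<in> carrier_mat n n"
      by (simp add: alt_forms_def)
    \<comment> \<open>An alternating form of odd size is singular, which supplies a central element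
      with nonzero first component.\<close>
    obtain v where v: "v \<in> carrier_vec n" "v \<noteq> 0\<^sub>v n" "(\<Phi> ! 0) *\<^sub>v v = 0\<^sub>v n"
      using det_alt_form_odd[OF A n] det_0_iff_vec_prod_zero[OF Ac] by blast
    have "(\<Sum>i<n. (\<Phi> ! 0) $$ (j, i) * v $ i) = 0" if "j < n" for j
    proof -
      have "((\<Phi> ! 0) *\<^sub>v v) $ j = (\<Sum>i<n. (\<Phi> ! 0) $$ (j, i) * v $ i)"
        using v(1) Ac that by (simp add: scalar_prod_def atLeast0LessThan)
      then show ?thesis
        using v(3) that by simp
    qed
    then have x: "(v, 0\<^sub>v 1) \<in> center ?G"
      unfolding C_iff using v(1) by simp
    have y: "(0\<^sub>v n, unit_vec 1 0) \<in> center ?G"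
      unfolding C_iff by simp
    show ?thesis
    \<comment> \<open>At the second witness \<open>f\<close> is 0 and \<open>g\<close> is 2; at the
      first, \<open>f\<close> cannot vanish by \<open>kernel\<close>.\<close>
    proof (rule ab_rank_ge_2[OF C.comm_group_axioms f g, where x = "(v, 0\<^sub>v 1)" and y = "(0\<^sub>v n, unit_vec 1 0)"])
      show "f (v, 0\<^sub>v 1) \<noteq> 0"
        using kernel[OF x] v(2) by (auto simp: f_def)
    qed (use x y n0 in \<open>auto simp: f_def g_def\<close>)
  qed
  ultimately show ?thesis
    by (rule antisym)
qed

section \<open>Genericity\<close>

text \<open>An isomorphism carries center to center and isolator to isolator. The flag
  \<open>b\<close> stands for the condition on \<open>n\<close> and \<open>t\<close>, which is the
  same for both groups.\<close>

lemma iso_invariant_center_property: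
  assumes "\<And>G. G \<in> \<C> \<Longrightarrow> group G"
  shows "iso_invariant_on \<C> (\<lambda>G. if b then ab_rank (G\<lparr>carrier := center G\<rparr>) = 2
    else center G = isolator G (commutator_subgroup G))"
  unfolding iso_invariant_on_def
proof (intro ballI impI)
  fix G H
  assume "G \<in> \<C>" "H \<in> \<C>" "G \<cong> H"
  then obtain h where h: "group G" "group H" "h \<in> iso G H"
    using assms by (auto simp: is_iso_def)
  assume "if b then ab_rank (G\<lparr>carrier := center G\<rparr>) = 2
    else center G = isolator G (commutator_subgroup G)"
  then show "if b then ab_rank (H\<lparr>carrier := center H\<rparr>) = 2
    else center H = isolator H (commutator_subgroup H)"
    using ab_rank_center_iso[OF h] center_iso_image[OF h]
      isolator_commutator_subgroup_iso_image[OF h] by (auto split: if_splits)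
qed

theorem theorem1:
  fixes n t :: nat
  assumes "n > 0" and "t > 0"
  shows "generic_N2 n t (\<lambda>G.
    if t = 1 \<and> odd n then ab_rank (G\<lparr>carrier := center G\<rparr>) = 2
    else center G = isolator G (commutator_subgroup G))"
proof -
  let ?\<A> = "\<lambda>G :: (int vec \<times> int vec) monoid. if t = 1 \<and> odd n then ab_rank (G\<lparr>carrier := center G\<rparr>) = 2
    else center G = isolator G (commutator_subgroup G)"
  have "\<exists>V. zariski_closed n t V \<and> V \<subset> alt_tuples n t \<and>
    rat_tuple ` {\<Phi> \<in> P_tuples n t. \<not> ?\<A> (form_group n t \<Phi>)} \<subseteq> V"
  \<comment> \<open>If \<open>n = 1\<close> and \<open>t > 1\<close>, all alternating forms are zero
    and there is no extra row, so \<open>kernel_poly\<close> vanishes identically on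
    \<open>alt_tuples\<close>; that case is treated apart.\<close>
  proof (cases "t = 1 \<or> n > 1")
    case True
    define V where "V = {\<Phi> \<in> alt_tuples n t. kernel_poly n t \<Phi> = 0}"
    have "zariski_closed n t V"
      unfolding zariski_closed_def V_def
      by (rule exI[of _ "{kernel_poly n t}"]) (simp add: kernel_poly_polynomial)
    moreover have "V \<subset> alt_tuples n t"
      using kernel_poly_nonzero_exists[OF \<open>t > 0\<close> True] by (auto simp: V_def)
    moreover have "rat_tuple \<Phi> \<in> V" if P: "\<Phi> \<in> P_tuples n t" and not: "\<not> ?\<A> (form_group n t \<Phi>)" for \<Phi>
    proof -
      have \<Phi>: "\<Phi> \<in> alt_tuples n t"
        using P by (simp add: P_tuples_def)
      have "kernel_poly n t (rat_tuple \<Phi>) = 0"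
      proof (rule ccontr)
        assume nz: "kernel_poly n t (rat_tuple \<Phi>) \<noteq> 0"
        show False
        proof (cases "t = 1 \<and> odd n")
          case True
          then show False
            using not ab_rank_center_form_group_odd[of \<Phi> n] \<Phi> nz by simp
        next
          case False
          then show False
            using not center_form_group_nondegenerate[OF \<Phi> nz False]
              isolator_commutator_subgroup_form_group[OF P] by auto
        qed
      qed
      then show ?thesis
        using rat_tuple_alt_tuples[OF \<Phi>] by (simp add: V_def)
    qed
    ultimately show ?thesis
      by (intro exI[of _ V]) blast
  next
    case False
    then have "n = 1"
      using \<open>n > 0\<close> by simp
    \<comment> \<open>No tuple is independent here, so the empty set serves as the exceptional set;
      the zero tuple shows that it is proper.\<close>
    have "zariski_closed n t {}"
      unfolding zariski_closed_def
      by (rule exI[of _ "{\<lambda>_. 1}"]) (simp add: polynomial_functions.const)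
    moreover have "replicate t (0\<^sub>m n n) \<in> alt_tuples n t"
      by (auto simp: alt_tuples_def alt_forms_def)
    ultimately show ?thesis
      using P_tuples_1_empty[OF \<open>t > 0\<close>] by (intro exI[of _ "{}"]) (auto simp: \<open>n = 1\<close>)
  qed
  moreover have "iso_invariant_on (N2 n t) ?\<A>"
    by (rule iso_invariant_center_property) (simp add: N2_def)
  ultimately show ?thesis
    unfolding generic_N2_def by blast
qed

end
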